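(* Let $m,n,s$ be positive integers. For $A,B\in\mathbb{R}^{m\times n\times s}$ define $$[A,B]_*:=A\ltimes_*B-B\ltimes_*A.$$ Then $(\mathbb{R}^{m\times n\times s},[\cdot,\cdot]_* )$ is a Lie algebra (over $\mathbb{R}$).
   Context: A cubic matrix $A=(a_{i,j,k})\in\mathbb{R}^{m\times n\times s}$ has frontal slices $A^{(k)}=(a_{i,j,k})_{i,j}\in\mathbb{R}^{m\times n}$, $k\in[1,s]$, and is identified with the $sm\times n$ block-column matrix with blocks $A^{(1)},\dots,A^{(s)}$. Addition and scalar multiplication are entrywise. $\Gamma(A)=\mathrm{bcirc}(A)\in\mathbb{R}^{sm\times sn}$ is the block circulant matrix whose $(a,b)$ block ($a,b\in[1,s]$) is $A^{(c)}$ with $c\in[1,s]$, $c\equiv a-b+1 \pmod s$. DK-STP of matrices: for $M\in\mathbb{R}^{m\times n}$, $N\in\mathbb{R}^{p\times q}$ and $t=\mathrm{lcm}(n,p)$, $M\ltimes_{DK} N:=(M\otimes \mathbf{1}_{t/n}^T)(N\otimes\mathbf{1}_{t/p})\in\mathbb{R}^{m\times q}$, where $\mathbf{1}_k$ is the all-ones column vector of length $k$. t-STP: for $A\in\mathbb{R}^{m\times n\times s}$, $B\in\mathbb{R}^{p\times q\times s}$, $A\ltimes_* B:=\Gamma(A)\ltimes_{DK}B$, where $B$ is taken as its $sp\times q$ block column, and the resulting $sm\times q$ matrix is identified with an element of $\mathbb{R}^{m\times q\times s}$. *)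

theory Defs
  imports "Jordan_Normal_Form.VS_Connect"
begin

text \<open>A cubic matrix of size \<open>m \<times> n \<times> s\<close> is the vector of its \<open>s\<close> frontal slices, so that
  \<open>A $ k $$ (i, j)\<close> is the entry with row index \<open>i\<close>, column index \<open>j\<close> and slice index \<open>k\<close>.
  All indices start at 0.\<close>

type_synonym cubic = "real mat vec"

definition cubic_carrier :: "nat \<Rightarrow> nat \<Rightarrow> nat \<Rightarrow> cubic set" where
  "cubic_carrier m n s = {A. dim_vec A = s \<and> (\<forall>k<s. A $ k \<in> carrier_mat m n)}"

text \<open>The row and column dimensions are read off from the slice 0, hence are only meaningful
  for cubic matrices with at least one slice.\<close>

definition cubic_rows :: "cubic \<Rightarrow> nat" where
  "cubic_rows A = dim_row (A $ 0)"

definition cubic_cols :: "cubic \<Rightarrow> nat" where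
  "cubic_cols A = dim_col (A $ 0)"

definition cubic_smult :: "real \<Rightarrow> cubic \<Rightarrow> cubic" where
  "cubic_smult c A = map_vec (\<lambda>M. c \<cdot>\<^sub>m M) A"

text \<open>The fields \<open>mult\<close> and \<open>one\<close> are not used by the notion of a vector space.\<close>

definition cubic_space :: "nat \<Rightarrow> nat \<Rightarrow> nat \<Rightarrow> (real, cubic) module" where
  "cubic_space m n s = \<lparr>
    carrier = cubic_carrier m n s,
    mult = undefined,
    one = undefined,
    zero = vec s (\<lambda>_. 0\<^sub>m m n),
    add = (+),
    smult = cubic_smult\<rparr>"

text \<open>The identification of \<open>m \<times> n \<times> s\<close> cubic matrices with \<open>sm \<times> n\<close> block columns,
  in both directions: row \<open>r\<close> of the block column is row \<open>r mod m\<close> of slice \<open>r div m\<close>.\<close>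

definition block_column :: "cubic \<Rightarrow> real mat" where
  "block_column A = (let m = cubic_rows A in
     mat (dim_vec A * m) (cubic_cols A) (\<lambda>(r, j). A $ (r div m) $$ (r mod m, j)))"

definition of_block_column :: "nat \<Rightarrow> real mat \<Rightarrow> cubic" where
  "of_block_column s M = (let m = dim_row M div s in
     vec s (\<lambda>k. mat m (dim_col M) (\<lambda>(i, j). M $$ (k * m + i, j))))"

text \<open>Block \<open>(a, b)\<close>, for \<open>a, b < s\<close>, is the slice with index \<open>a - b\<close> modulo \<open>s\<close>. With indices
  starting at 0 the usual offset \<open>+ 1\<close> disappears; the summand \<open>s\<close> avoids truncated subtraction.\<close>

definition bcirc :: "cubic \<Rightarrow> real mat" where
  "bcirc A = (let s = dim_vec A; m = cubic_rows A; n = cubic_cols A in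
     mat (s * m) (s * n)
       (\<lambda>(r, c). A $ ((s + r div m - c div n) mod s) $$ (r mod m, c mod n)))"

definition kronecker :: "real mat \<Rightarrow> real mat \<Rightarrow> real mat" (infixl \<open>\<otimes>\<^sub>K\<close> 75) where
  "M \<otimes>\<^sub>K N = mat (dim_row M * dim_row N) (dim_col M * dim_col N)
     (\<lambda>(i, j). M $$ (i div dim_row N, j div dim_col N) * N $$ (i mod dim_row N, j mod dim_col N))"

definition ones :: "nat \<Rightarrow> real mat" where
  "ones k = mat k 1 (\<lambda>_. 1)"

definition dk_stp :: "real mat \<Rightarrow> real mat \<Rightarrow> real mat" (infixl \<open>\<ltimes>\<^sub>D\<^sub>K\<close> 70) where
  "M \<ltimes>\<^sub>D\<^sub>K N = (let n = dim_col M; p = dim_row N; t = lcm n p in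
     (M \<otimes>\<^sub>K transpose_mat (ones (t div n))) * (N \<otimes>\<^sub>K ones (t div p)))"

definition t_stp :: "cubic \<Rightarrow> cubic \<Rightarrow> cubic" (infixl \<open>\<ltimes>\<^sub>*\<close> 70) where
  "A \<ltimes>\<^sub>* B = of_block_column (dim_vec A) (bcirc A \<ltimes>\<^sub>D\<^sub>K block_column B)"

definition t_bracket :: "cubic \<Rightarrow> cubic \<Rightarrow> cubic" where
  "t_bracket A B = A \<ltimes>\<^sub>* B - B \<ltimes>\<^sub>* A"

locale lie_algebra = vectorspace K L
  for K :: "('k, 'r) ring_scheme" and L :: "('k, 'a, 'l) module_scheme" (structure) +
  fixes bracket :: "'a \<Rightarrow> 'a \<Rightarrow> 'a" (\<open>[_,_]\<^sub>L\<close>)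
  assumes bracket_closed:
      "\<lbrakk>x \<in> carrier L; y \<in> carrier L\<rbrakk> \<Longrightarrow> [x, y]\<^sub>L \<in> carrier L"
    and bracket_add_left:
      "\<lbrakk>x \<in> carrier L; y \<in> carrier L; z \<in> carrier L\<rbrakk>
        \<Longrightarrow> [x \<oplus> y, z]\<^sub>L = [x, z]\<^sub>L \<oplus> [y, z]\<^sub>L"
    and bracket_add_right:
      "\<lbrakk>x \<in> carrier L; y \<in> carrier L; z \<in> carrier L\<rbrakk>
        \<Longrightarrow> [x, y \<oplus> z]\<^sub>L = [x, y]\<^sub>L \<oplus> [x, z]\<^sub>L"
    and bracket_smult_left:
      "\<lbrakk>c \<in> carrier K; x \<in> carrier L; y \<in> carrier L\<rbrakk>
        \<Longrightarrow> [c \<odot> x, y]\<^sub>L = c \<odot> [x, y]\<^sub>L"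
    and bracket_smult_right:
      "\<lbrakk>c \<in> carrier K; x \<in> carrier L; y \<in> carrier L\<rbrakk>
        \<Longrightarrow> [x, c \<odot> y]\<^sub>L = c \<odot> [x, y]\<^sub>L"
    and bracket_self:
      "x \<in> carrier L \<Longrightarrow> [x, x]\<^sub>L = \<zero>"
    and jacobi:
      "\<lbrakk>x \<in> carrier L; y \<in> carrier L; z \<in> carrier L\<rbrakk>
        \<Longrightarrow> [x, [y, z]\<^sub>L]\<^sub>L \<oplus> [y, [z, x]\<^sub>L]\<^sub>L \<oplus> [z, [x, y]\<^sub>L]\<^sub>L = \<zero>"

end

theory Submission
  imports Defs
begin

text \<open>Since \<open>lcm (s n) (s m) = s lcm n m\<close>, the matrix that \<open>dk_stp\<close> inserts between the two factors of
  \<open>A \<ltimes>\<^sub>* B\<close> is block diagonal with \<open>s\<close> equal blocks \<open>P\<close> of size \<open>n \<times> m\<close>. Hence slice \<open>k\<close> of the product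
  is the cyclic convolution \<open>\<Sum>l. A\<^sub>k\<^sub>-\<^sub>l P B\<^sub>l\<close>, which makes \<open>\<ltimes>\<^sub>*\<close> associative as well as bilinear, and
  \<open>t_bracket\<close> is the commutator of an associative algebra.\<close>

section \<open>Block sums and cyclic indices\<close>

lemma sum_lessThan_mult:
  fixes f :: "nat \<Rightarrow> 'a::comm_monoid_add"
  shows "sum f {..<n * k} = (\<Sum>l<n. \<Sum>q<k. f (l * k + q))"
proof -
  have "sum f {l * k..<l * k + k} = (\<Sum>q<k. f (l * k + q))" for l
    by (simp add: sum.atLeastLessThan_shift_0[of f "l * k"] lessThan_atLeast0)
  then show ?thesis
    by (simp flip: sum.nat_group)
qed

text \<open>The argument stays below \<open>2 * s\<close>, so reduction subtracts \<open>s\<close>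
  at most once. The case split turns residue identities into linear arithmetic.\<close>

lemma cyclic_diff_mod:
  fixes a b s :: nat
  assumes "a < s" "b < s"
  shows "(s + a - b) mod s = (if b \<le> a then a - b else s + a - b)"
  using assms by (auto simp: mod_if)

text \<open>Substituting \<open>i - l\<close> for \<open>i\<close> permutes the residues modulo
  \<open>s\<close>, and \<open>(k - l) - (i - l) = k - i\<close>. This is the reason why cyclic
  convolution is associative.\<close>

lemma sum_cyclic_shift:
  fixes F :: "nat \<Rightarrow> nat \<Rightarrow> 'a::comm_monoid_add"
  assumes "k < s" "l < s"
  shows "(\<Sum>i<s. F ((s + k - i) mod s) ((s + i - l) mod s))
    = (\<Sum>i<s. F ((s + (s + k - l) mod s - i) mod s) i)"
proof (rule sum.reindex_bij_witness[where i = "\<lambda>i. (l + i) mod s" and j = "\<lambda>i. (s + i - l) mod s"])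
  fix i assume "i \<in> {..<s}"
  then have i: "i < s" by simp
  show "(l + (s + i - l) mod s) mod s = i"
    using i assms by (simp add: cyclic_diff_mod mod_if)
  show "(s + (l + i) mod s - l) mod s = i"
    using i assms by (simp add: cyclic_diff_mod mod_if)
  show "(s + i - l) mod s \<in> {..<s}" "(l + i) mod s \<in> {..<s}"
    using i by simp_all
  have "(s + (s + k - l) mod s - (s + i - l) mod s) mod s
      = (if (s + i - l) mod s \<le> (s + k - l) mod s then (s + k - l) mod s - (s + i - l) mod s
        else s + (s + k - l) mod s - (s + i - l) mod s)"
    using i by (intro cyclic_diff_mod) simp_all
  also have "\<dots> = (s + k - i) mod s"
    using i assms by (auto simp: cyclic_diff_mod)
  finally have "(s + k - i) mod s = (s + (s + k - l) mod s - (s + i - l) mod s) mod s" ..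
  then show "F ((s + (s + k - l) mod s - (s + i - l) mod s) mod s) ((s + i - l) mod s)
      = F ((s + k - i) mod s) ((s + i - l) mod s)"
    by simp
qed

section \<open>Cubic matrices as a real vector space\<close>

lemma cubic_eqI:
  assumes "A \<in> cubic_carrier m n s" "B \<in> cubic_carrier m n s"
    and "\<And>k i j. \<lbrakk>k < s; i < m; j < n\<rbrakk> \<Longrightarrow> A $ k $$ (i, j) = B $ k $$ (i, j)"
  shows "A = B"
proof (rule eq_vecI)
  show "dim_vec A = dim_vec B"
    using assms by (simp add: cubic_carrier_def)
  fix k assume "k < dim_vec B"
  then have "A $ k \<in> carrier_mat m n" "B $ k \<in> carrier_mat m n" "k < s"
    using assms by (auto simp: cubic_carrier_def)
  then show "A $ k = B $ k"
    using assms(3) by (intro eq_matI) auto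
qed

lemma cubic_zero_closed: "vec s (\<lambda>_. 0\<^sub>m m n) \<in> cubic_carrier m n s"
  and cubic_add_closed:
    "\<lbrakk>A \<in> cubic_carrier m n s; B \<in> cubic_carrier m n s\<rbrakk> \<Longrightarrow> A + B \<in> cubic_carrier m n s"
  and cubic_minus_closed:
    "\<lbrakk>A \<in> cubic_carrier m n s; B \<in> cubic_carrier m n s\<rbrakk> \<Longrightarrow> A - B \<in> cubic_carrier m n s"
  and cubic_smult_closed:
    "A \<in> cubic_carrier m n s \<Longrightarrow> cubic_smult c A \<in> cubic_carrier m n s"
  by (auto simp: cubic_carrier_def cubic_smult_def minus_carrier_mat)

lemmas cubic_closed = cubic_zero_closed cubic_add_closed cubic_minus_closed cubic_smult_closed

lemma cubic_entry:
  assumes "k < s" "i < m" "j < n"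
  shows "vec s (\<lambda>_. 0\<^sub>m m n) $ k $$ (i, j) = 0"
    and "\<lbrakk>A \<in> cubic_carrier m n s; B \<in> cubic_carrier m n s\<rbrakk>
      \<Longrightarrow> (A + B) $ k $$ (i, j) = A $ k $$ (i, j) + B $ k $$ (i, j)"
    and "\<lbrakk>A \<in> cubic_carrier m n s; B \<in> cubic_carrier m n s\<rbrakk>
      \<Longrightarrow> (A - B) $ k $$ (i, j) = A $ k $$ (i, j) - B $ k $$ (i, j)"
    and "A \<in> cubic_carrier m n s \<Longrightarrow> cubic_smult c A $ k $$ (i, j) = c * A $ k $$ (i, j)"
  using assms by (auto simp: cubic_carrier_def cubic_smult_def)

lemma vectorspace_cubic_space: "vectorspace (class_ring :: real ring) (cubic_space m n s)"
proof -
  note entry = cubic_entry[where m = m and n = n and s = s]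
  have "abelian_group (cubic_space m n s)"
  proof (rule abelian_groupI)
    fix x assume "x \<in> carrier (cubic_space m n s)"
    then show "\<exists>y\<in>carrier (cubic_space m n s). y \<oplus>\<^bsub>cubic_space m n s\<^esub> x = \<zero>\<^bsub>cubic_space m n s\<^esub>"
      by (intro bexI[of _ "cubic_smult (- 1) x"])
        (auto simp: cubic_space_def cubic_closed entry intro!: cubic_eqI[of _ m n s])
  qed (auto simp: cubic_space_def cubic_closed entry intro!: cubic_eqI[of _ m n s])
  then have "module (class_ring :: real ring) (cubic_space m n s)"
    by (intro moduleI)
      (auto simp: cubic_space_def cubic_closed entry algebra_simps class_cring.is_cring
        intro!: cubic_eqI[of _ m n s])
  then show ?thesis
    using class_field by (simp add: vectorspace_def)
qed

section \<open>Entries of the t-STP\<close>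

context
  fixes m n s :: nat
  assumes pos: "0 < m" "0 < n" "0 < s"
begin

lemma lcm_div_pos: "0 < lcm n m div n" "0 < lcm n m div m"
  using pos by (auto simp: div_greater_zero_iff lcm_pos_nat intro: dvd_imp_le)

lemma div_lcm_div_less:
  assumes "q < lcm n m"
  shows "q div (lcm n m div n) < n" "q div (lcm n m div m) < m"
  using assms lcm_div_pos by (auto simp: less_mult_imp_div_less)

text \<open>The Kronecker factors of ones repeat each column of \<open>M\<close> and each row of
  \<open>N\<close>. Both inner dimensions carry the factor \<open>s\<close>, which cancels from the
  repetition counts.\<close>

lemma dk_stp_index:
  assumes M: "M \<in> carrier_mat p (s * n)" and N: "N \<in> carrier_mat (s * m) q"
    and r: "r < p" and j: "j < q"
  shows "(M \<ltimes>\<^sub>D\<^sub>K N) $$ (r, j) = (\<Sum>c<s * lcm n m.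
    M $$ (r, c div (lcm n m div n)) * N $$ (c div (lcm n m div m), j))"
proof -
  have lcm: "lcm (s * n) (s * m) = s * lcm n m"
    by (simp add: lcm_mult_left)
  have dims: "s * n * (lcm n m div n) = s * lcm n m" "s * m * (lcm n m div m) = s * lcm n m"
    by (simp_all add: mult.assoc)
  show ?thesis
    using M N r j pos lcm_div_pos
    by (simp add: dk_stp_def lcm kronecker_def ones_def Let_def scalar_prod_def dims
        lessThan_atLeast0)
qed

text \<open>The sum over \<open>q\<close> is the entry of a product through \<open>P\<close>:
  \<open>P\<close> at \<open>(x, y)\<close> counts the \<open>q\<close> with
  \<open>q div (lcm n m div n) = x\<close> and \<open>q div (lcm n m div m) = y\<close>.\<close>

lemma t_stp_index:
  assumes A: "A \<in> cubic_carrier m n s" and B: "B \<in> cubic_carrier m n s"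
    and k: "k < s" and i: "i < m" and j: "j < n"
  shows "(A \<ltimes>\<^sub>* B) $ k $$ (i, j) = (\<Sum>l<s. \<Sum>q<lcm n m.
    A $ ((s + k - l) mod s) $$ (i, q div (lcm n m div n)) * B $ l $$ (q div (lcm n m div m), j))"
proof -
  define a where "a = lcm n m div n"
  define b where "b = lcm n m div m"
  have ab: "lcm n m = n * a" "lcm n m = m * b" "0 < a" "0 < b"
    using lcm_div_pos by (auto simp: a_def b_def)
  \<comment> \<open>Slice 0 exists because \<open>s\<close> is positive, so the dimensions read off
    from it are the intended ones.\<close>
  have dims: "dim_vec A = s" "dim_vec B = s" "cubic_rows A = m" "cubic_rows B = m"
    "cubic_cols A = n" "cubic_cols B = n"
    using A B pos by (auto simp: cubic_carrier_def cubic_rows_def cubic_cols_def)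
  have M: "bcirc A \<in> carrier_mat (s * m) (s * n)" and N: "block_column B \<in> carrier_mat (s * m) n"
    by (simp_all add: bcirc_def block_column_def dims Let_def)
  have D: "bcirc A \<ltimes>\<^sub>D\<^sub>K block_column B \<in> carrier_mat (s * m) n"
    using M N by (intro carrier_matI) (simp_all add: dk_stp_def kronecker_def ones_def Let_def)
  have lt: "l * x + q < s * x" if "l < s" "q < x" for l q x :: nat
  proof -
    have "l * x + q < Suc l * x" using that by simp
    also have "\<dots> \<le> s * x" using that by (intro mult_le_mono1) simp
    finally show ?thesis .
  qed
  have km: "k * m + i < s * m"
    using k i by (rule lt)
  have "(A \<ltimes>\<^sub>* B) $ k $$ (i, j) = (bcirc A \<ltimes>\<^sub>D\<^sub>K block_column B) $$ (k * m + i, j)"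
    using D k i j pos by (simp add: t_stp_def of_block_column_def dims Let_def)
  also have "\<dots> = (\<Sum>l<s. \<Sum>q<lcm n m. bcirc A $$ (k * m + i, (l * lcm n m + q) div a)
      * block_column B $$ ((l * lcm n m + q) div b, j))"
    unfolding dk_stp_index[OF M N km j] a_def b_def by (rule sum_lessThan_mult)
  also have "\<dots> = (\<Sum>l<s. \<Sum>q<lcm n m. A $ ((s + k - l) mod s) $$ (i, q div a) * B $ l $$ (q div b, j))"
  proof (intro sum.cong refl)
    fix l q assume "l \<in> {..<s}" "q \<in> {..<lcm n m}"
    then have l: "l < s" and q: "q < lcm n m" by simp_all
    have qa: "q div a < n" and qb: "q div b < m"
      using div_lcm_div_less[OF q] by (simp_all add: a_def b_def)
    \<comment> \<open>A block of length \<open>lcm n m\<close> consists of exactly \<open>n\<close>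
      runs of length \<open>a\<close> and of \<open>m\<close> runs of length \<open>b\<close>, so no
      run crosses a block boundary.\<close>
    have "l * lcm n m + q = q + (l * n) * a"
      by (simp add: ab(1))
    then have ca: "(l * lcm n m + q) div a = l * n + q div a"
      using ab(3) by (simp only: div_mult_self1)
    have "l * lcm n m + q = q + (l * m) * b"
      by (simp add: ab(2))
    then have cb: "(l * lcm n m + q) div b = l * m + q div b"
      using ab(4) by (simp only: div_mult_self1)
    show "bcirc A $$ (k * m + i, (l * lcm n m + q) div a) * block_column B $$ ((l * lcm n m + q) div b, j)
      = A $ ((s + k - l) mod s) $$ (i, q div a) * B $ l $$ (q div b, j)"
      unfolding ca cb using km lt[OF l qa] lt[OF l qb] qa qb i j
      by (simp add: bcirc_def block_column_def dims Let_def)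
  qed
  finally show ?thesis unfolding a_def b_def .
qed

lemma t_stp_closed:
  assumes A: "A \<in> cubic_carrier m n s" and B: "B \<in> cubic_carrier m n s"
  shows "A \<ltimes>\<^sub>* B \<in> cubic_carrier m n s"
proof -
  have "dim_vec A = s" "dim_vec B = s" "cubic_rows A = m" "cubic_cols B = n"
    using A B pos by (auto simp: cubic_carrier_def cubic_rows_def cubic_cols_def)
  then show ?thesis
    using pos by (simp add: cubic_carrier_def t_stp_def of_block_column_def dk_stp_def kronecker_def
        ones_def bcirc_def block_column_def Let_def)
qed

section \<open>Bilinearity and associativity\<close>

lemmas t_stp_simps = cubic_closed t_stp_closed cubic_entry[where m = m and n = n and s = s] t_stp_index div_lcm_div_less

text \<open>The entry formulas need index bounds. Under the sums, \<open>sum.cong_simp\<close>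
  provides the ranges, from which \<open>div_lcm_div_less\<close> derives the bounds.\<close>

lemma t_stp_add_left:
  assumes "A \<in> cubic_carrier m n s" "B \<in> cubic_carrier m n s" "C \<in> cubic_carrier m n s"
  shows "(A + B) \<ltimes>\<^sub>* C = A \<ltimes>\<^sub>* C + B \<ltimes>\<^sub>* C"
  using assms pos by (intro cubic_eqI[of _ m n s]) (simp_all add: t_stp_simps sum.distrib algebra_simps cong: sum.cong_simp)

lemma t_stp_add_right:
  assumes "A \<in> cubic_carrier m n s" "B \<in> cubic_carrier m n s" "C \<in> cubic_carrier m n s"
  shows "A \<ltimes>\<^sub>* (B + C) = A \<ltimes>\<^sub>* B + A \<ltimes>\<^sub>* C"
  using assms pos by (intro cubic_eqI[of _ m n s]) (simp_all add: t_stp_simps sum.distrib algebra_simps cong: sum.cong_simp)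

lemma t_stp_minus_left:
  assumes "A \<in> cubic_carrier m n s" "B \<in> cubic_carrier m n s" "C \<in> cubic_carrier m n s"
  shows "(A - B) \<ltimes>\<^sub>* C = A \<ltimes>\<^sub>* C - B \<ltimes>\<^sub>* C"
  using assms pos by (intro cubic_eqI[of _ m n s]) (simp_all add: t_stp_simps sum_subtractf algebra_simps cong: sum.cong_simp)

lemma t_stp_minus_right:
  assumes "A \<in> cubic_carrier m n s" "B \<in> cubic_carrier m n s" "C \<in> cubic_carrier m n s"
  shows "A \<ltimes>\<^sub>* (B - C) = A \<ltimes>\<^sub>* B - A \<ltimes>\<^sub>* C"
  using assms pos by (intro cubic_eqI[of _ m n s]) (simp_all add: t_stp_simps sum_subtractf algebra_simps cong: sum.cong_simp)

lemma t_stp_smult_left: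
  assumes "A \<in> cubic_carrier m n s" "B \<in> cubic_carrier m n s"
  shows "cubic_smult c A \<ltimes>\<^sub>* B = cubic_smult c (A \<ltimes>\<^sub>* B)"
  using assms pos by (intro cubic_eqI[of _ m n s]) (simp_all add: t_stp_simps sum_distrib_left algebra_simps cong: sum.cong_simp)

lemma t_stp_smult_right:
  assumes "A \<in> cubic_carrier m n s" "B \<in> cubic_carrier m n s"
  shows "A \<ltimes>\<^sub>* cubic_smult c B = cubic_smult c (A \<ltimes>\<^sub>* B)"
  using assms pos by (intro cubic_eqI[of _ m n s]) (simp_all add: t_stp_simps sum_distrib_left algebra_simps cong: sum.cong_simp)

lemma t_stp_assoc:
  assumes A: "A \<in> cubic_carrier m n s" and B: "B \<in> cubic_carrier m n s"
    and C: "C \<in> cubic_carrier m n s"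
  shows "(A \<ltimes>\<^sub>* B) \<ltimes>\<^sub>* C = A \<ltimes>\<^sub>* (B \<ltimes>\<^sub>* C)"
proof (rule cubic_eqI)
  show "(A \<ltimes>\<^sub>* B) \<ltimes>\<^sub>* C \<in> cubic_carrier m n s" "A \<ltimes>\<^sub>* (B \<ltimes>\<^sub>* C) \<in> cubic_carrier m n s"
    using assms by (simp_all add: t_stp_closed)
  fix k i j assume k: "k < s" and i: "i < m" and j: "j < n"
  let ?T = "lcm n m"
  let ?a = "?T div n" and ?b = "?T div m"
  \<comment> \<open>\<open>G l x y\<close> is the entry \<open>(i, j)\<close> of
    \<open>A\<^sub>x P B\<^sub>y P C\<^sub>l\<close>. Both bracketings sum it over the index triples
    with \<open>x + y + l = k\<close> modulo \<open>s\<close>.\<close>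
  define G where "G l x y = (\<Sum>p<?T. \<Sum>q<?T.
    A $ x $$ (i, p div ?a) * B $ y $$ (p div ?b, q div ?a) * C $ l $$ (q div ?b, j))" for l x y
  have "((A \<ltimes>\<^sub>* B) \<ltimes>\<^sub>* C) $ k $$ (i, j)
    = (\<Sum>l<s. \<Sum>q<?T. \<Sum>l'<s. \<Sum>p<?T. A $ ((s + (s + k - l) mod s - l') mod s) $$ (i, p div ?a)
        * B $ l' $$ (p div ?b, q div ?a) * C $ l $$ (q div ?b, j))"
    using assms k i j pos by (simp add: t_stp_simps sum_distrib_right cong: sum.cong_simp)
  also have "\<dots> = (\<Sum>l<s. \<Sum>l'<s. G l ((s + (s + k - l) mod s - l') mod s) l')"
    unfolding G_def by (subst sum.swap, subst (3) sum.swap) (rule refl)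
  \<comment> \<open>For fixed \<open>l\<close>, the index \<open>l'\<close> of the slice of
    \<open>B\<close> becomes the index of a slice of \<open>B \<ltimes>\<^sub>* C\<close>.\<close>
  also have "\<dots> = (\<Sum>l<s. \<Sum>l'<s. G l ((s + k - l') mod s) ((s + l' - l) mod s))"
    using k by (intro sum.cong refl sum_cyclic_shift[symmetric]) simp_all
  also have "\<dots> = (\<Sum>l'<s. \<Sum>p<?T. \<Sum>l<s. \<Sum>q<?T. A $ ((s + k - l') mod s) $$ (i, p div ?a)
        * B $ ((s + l' - l) mod s) $$ (p div ?b, q div ?a) * C $ l $$ (q div ?b, j))"
    unfolding G_def by (subst sum.swap) (intro sum.cong refl sum.swap)
  also have "\<dots> = (A \<ltimes>\<^sub>* (B \<ltimes>\<^sub>* C)) $ k $$ (i, j)"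
    using assms k i j pos by (simp add: t_stp_simps sum_distrib_left mult.assoc cong: sum.cong_simp)
  finally show "((A \<ltimes>\<^sub>* B) \<ltimes>\<^sub>* C) $ k $$ (i, j) = (A \<ltimes>\<^sub>* (B \<ltimes>\<^sub>* C)) $ k $$ (i, j)" .
qed

end

theorem proposition16:
  fixes m n s :: nat
  assumes "m \<ge> 1" and "n \<ge> 1" and "s \<ge> 1"
  shows "lie_algebra (class_ring :: real ring) (cubic_space m n s) t_bracket"
proof -
  have pos: "0 < m" "0 < n" "0 < s"
    using assms by simp_all
  note closed = cubic_closed t_stp_closed[OF pos]
  note bilinear = t_stp_add_left[OF pos] t_stp_add_right[OF pos] t_stp_minus_left[OF pos]
    t_stp_minus_right[OF pos] t_stp_smult_left[OF pos] t_stp_smult_right[OF pos]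
  \<comment> \<open>Expanding the nested commutators in the Jacobi identity gives twelve triple
    products: each of the six orderings of the factors occurs once with either sign, and they cancel
    entrywise.\<close>
  have "lie_algebra_axioms (class_ring :: real ring) (cubic_space m n s) t_bracket"
    by unfold_locales
      (auto simp: cubic_space_def t_bracket_def closed bilinear t_stp_assoc[OF pos]
        cubic_entry[where m = m and n = n and s = s]
        algebra_simps intro!: cubic_eqI[of _ m n s])
  then show ?thesis
    using vectorspace_cubic_space by (rule lie_algebra.intro[rotated])
qed

end
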